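(* For each integer $m\geq 0$, $$\frac{\pi}{6} = \ln\left(\frac{(9+5\sqrt{3})\sqrt{5}\Big(\sqrt{5}F_{2m+1}^2+F_{2m+1} \sqrt{5F_{2m+1}^2+4(2-\sqrt{3})^2}\Big) +4}{(5+3\sqrt{3})\sqrt{5}\Big(\sqrt{5}F_{2m+1}^2+F_{2m+1} \sqrt{5F_{2m+1}^2+4(2-\sqrt{3})^2}\Big) +4}\right) - 4\sqrt{5}\sum_{n=0}^\infty \frac{1}{4n+3} F_{(2m+1)(4n+3)}\Big(\frac{2(2-\sqrt{3})}{\sqrt{5}F_{2m+1} + \sqrt{5F_{2m+1}^2+4(2-\sqrt{3})^2}}\Big )^{4n+3},$$ where $F_k$ denotes the $k$-th Fibonacci number.
   Context: The Fibonacci numbers are defined by $F_0=0$, $F_1=1$, and $F_{n+2}=F_{n+1}+F_n$ for $n\ge 0$. *)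

theory Defs
  imports Complex_Main "HOL-Number_Theory.Fib"
begin

end

(* For odd k, Binet's formula reads sqrt 5 * fib (k * j) = A^j + B^j for every odd j, where
   A = phi^k and B = 1/A.  Up to a factor 4 * sqrt 5 the series is therefore twice the sum of
   artanh - arctan at A x and at B x.  The x of the theorem is the positive root of
   (A + B) x = c (1 - x^2) with c = 2 - sqrt 3 = tan (pi/12), so that
   arctan (A x) + arctan (B x) = arctan c = pi/12, while the two artanh terms combine to a
   logarithm. *)
theory Submission
  imports Defs "HOL-Analysis.Complex_Transcendental"
begin

text \<open>\<open>ln_series_quadratic\<close> expands \<open>ln z\<close> in odd powers of (z - 1)
  / (z + 1), which equals \<open>y\<close> for z = (1 + y) / (1 - y).\<close>

lemma artanh_real_sums:
  fixes y :: real
  assumes "\<bar>y\<bar> < 1"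
  shows "(\<lambda>n. y ^ (2*n+1) / real (2*n+1)) sums artanh y"
proof -
  have pos: "(1 + y) / (1 - y) > 0"
    using assms by (auto simp: abs_less_iff)
  have "((1 + y) / (1 - y) - 1) / ((1 + y) / (1 - y) + 1) = y"
    using assms by (simp add: divide_simps abs_less_iff)
  then have "(\<lambda>n. 2 * y ^ (2*n+1) / real (2*n+1)) sums ln ((1 + y) / (1 - y))"
    using ln_series_quadratic[OF pos] by simp
  from sums_divide[OF this, of 2]
  have sums: "(\<lambda>n. 2 * y ^ (2*n+1) / real (2*n+1) / 2) sums artanh y"
    by (simp only: artanh_def)
  have "2 * a / b / 2 = a / b" for a b :: real
    by simp
  from sums[unfolded this] show ?thesis .
qed

text \<open>Both series run over odd powers with the same coefficients up to sign: the terms cancel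
  at exponents 1 mod 4 and double at exponents 3 mod 4.\<close>

lemma artanh_minus_arctan_sums:
  fixes y :: real
  assumes "\<bar>y\<bar> < 1"
  shows "(\<lambda>n. y ^ (4*n+3) / real (4*n+3)) sums ((artanh y - arctan y) / 2)"
proof -
  have "(\<lambda>k. (-1)^k * (1 / real (k*2+1) * y ^ (k*2+1))) sums arctan y"
    using assms summable_arctan_series[of y] arctan_series[of y] by (simp add: sums_iff)
  then have sums: "(\<lambda>k. (y ^ (2*k+1) / real (2*k+1)
      - (-1)^k * (1 / real (k*2+1) * y ^ (k*2+1))) / 2) sums ((artanh y - arctan y) / 2)"
    (is "?f sums _")
    by (intro sums_divide sums_diff artanh_real_sums assms)
  \<comment> \<open>Only odd indices n = 2k+1 survive, and there the exponent 2n+1 is 4k+3.\<close>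
  have "?f n = 0" if "n \<notin> range (\<lambda>k. 2*k+1)" for n
  proof -
    have "even n" using that by (metis oddE rangeI)
    then show ?thesis by (simp add: mult.commute)
  qed
  then have "(\<lambda>k. ?f (2*k+1)) sums ((artanh y - arctan y) / 2)"
    using sums sums_mono_reindex[of "\<lambda>k. 2*k+1" ?f] by (simp add: strict_mono_def)
  moreover have "?f (2*k+1) = y ^ (4*k+3) / real (4*k+3)" for k
  proof -
    have "2 * (2*k+1) + 1 = 4*k+3" "(2*k+1) * 2 + 1 = 4*k+3" "(-1) ^ (2*k+1) = (-1::real)"
      by simp_all
    moreover have "(a / b - (-1) * (1 / b * a)) / 2 = a / b" for a b :: real
      by simp
    ultimately show ?thesis by (simp only:)
  qed
  ultimately show ?thesis by simp
qed

text \<open>The conjugate of the golden ratio is minus its reciprocal, so an odd power turns the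
  difference in Binet's formula into a sum of positive terms.\<close>

lemma sqrt5_fib_odd:
  assumes "odd n"
  shows "sqrt 5 * real (fib n) = ((1 + sqrt 5) / 2) ^ n + (1 / ((1 + sqrt 5) / 2)) ^ n"
proof -
  have "(1 + sqrt 5) * (1 - sqrt 5) = - (4::real)"
    by (simp add: algebra_simps)
  moreover have "1 + sqrt 5 > (0::real)"
    by (simp add: add_pos_pos)
  ultimately have "(1 - sqrt 5) / 2 = - (1 / ((1 + sqrt 5) / 2))"
    by (simp add: field_simps)
  then have "((1 - sqrt 5) / 2) ^ n = - ((1 / ((1 + sqrt 5) / 2)) ^ n)"
    by (simp only: power_minus_odd[OF assms])
  then show ?thesis
    using fib_closed_form[of n] by simp
qed

text \<open>The right side involves only u + v and u * v, which are the quantities known when u = A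
  x and v = B x.\<close>

lemma artanh_add:
  fixes u v :: real
  assumes "\<bar>u\<bar> < 1" "\<bar>v\<bar> < 1"
  shows "2 * (artanh u + artanh v) = ln ((1 + u * v + (u + v)) / (1 + u * v - (u + v)))"
proof -
  have "2 * (artanh u + artanh v) = ln (((1 + u) / (1 - u)) * ((1 + v) / (1 - v)))"
    using assms by (subst ln_mult_pos) (auto simp: artanh_def abs_less_iff)
  also have "((1 + u) / (1 - u)) * ((1 + v) / (1 - v))
      = (1 + u * v + (u + v)) / (1 + u * v - (u + v))"
    by (simp add: algebra_simps)
  finally show ?thesis .
qed

lemma fib_multiples_4n3_sums:
  fixes c x :: real
  assumes k: "odd k" and c: "0 < c" "c \<le> 1" and x: "x > 0"
    and eq: "sqrt 5 * real (fib k) * x = c * (1 - x\<^sup>2)"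
  shows "(\<lambda>n. 1 / (4 * real n + 3) * real (fib (k * (4*n+3))) * x ^ (4*n+3)) sums
     ((ln ((1 + x\<^sup>2 + c * (1 - x\<^sup>2)) / (1 + x\<^sup>2 - c * (1 - x\<^sup>2))) - 2 * arctan c) / (4 * sqrt 5))"
proof -
  define A :: real where "A = ((1 + sqrt 5) / 2) ^ k"
  define B :: real where "B = (1 / ((1 + sqrt 5) / 2)) ^ k"
  have gt: "1 + sqrt 5 > (0::real)"
    by (simp add: add_pos_pos)
  then have pos: "A > 0" "B > 0"
    by (simp_all add: A_def B_def)
  have "u * (1 / u) = 1" if "u > 0" for u :: real
    using that by simp
  from this[OF half_gt_zero[OF gt]] have AB: "A * B = 1"
    unfolding A_def B_def power_mult_distrib[symmetric] by (simp only: power_one)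
  have sum: "A * x + B * x = c * (1 - x\<^sup>2)"
    using sqrt5_fib_odd[OF k] eq by (simp add: A_def B_def flip: distrib_right)
  have prod: "(A * x) * (B * x) = x\<^sup>2"
    using AB by (simp add: power2_eq_square algebra_simps)
  \<comment> \<open>Being equal to A x + B x, this product is positive, which yields x^2 < 1;
    together with \<open>c \<le> 1\<close> it is also below 1, so A x and B x both lie in (0, 1),
    where the series converge.\<close>
  have "0 < c * (1 - x\<^sup>2)"
    using pos x by (simp flip: sum add: add_pos_pos)
  have "A * x > 0" "B * x > 0"
    using pos x by simp_all
  have x1: "x\<^sup>2 < 1"
    using \<open>0 < c * (1 - x\<^sup>2)\<close> c by (simp add: zero_less_mult_iff)
  have "c * (1 - x\<^sup>2) < 1"
  proof -
    have "c * (1 - x\<^sup>2) \<le> 1 * (1 - x\<^sup>2)"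
      using c x1 by (intro mult_right_mono) simp_all
    also have "\<dots> < 1"
      using x by simp
    finally show ?thesis .
  qed
  with sum \<open>A * x > 0\<close> \<open>B * x > 0\<close> have small: "\<bar>A * x\<bar> < 1" "\<bar>B * x\<bar> < 1"
    by auto
  \<comment> \<open>The addition formula gives the argument c (1 - x^2) / (1 - x^2), and x^2 < 1
    permits the cancellation.\<close>
  have "arctan (A * x) + arctan (B * x) = arctan c"
    using arctan_add[of "A * x" "B * x"] small x1 by (simp only: sum prod) simp
  moreover have "2 * (artanh (A * x) + artanh (B * x))
      = ln ((1 + x\<^sup>2 + c * (1 - x\<^sup>2)) / (1 + x\<^sup>2 - c * (1 - x\<^sup>2)))"
    using artanh_add[OF small] by (simp only: sum prod)
  ultimately have limit: "((artanh (A * x) - arctan (A * x)) / 2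
        + (artanh (B * x) - arctan (B * x)) / 2) / sqrt 5
      = (ln ((1 + x\<^sup>2 + c * (1 - x\<^sup>2)) / (1 + x\<^sup>2 - c * (1 - x\<^sup>2))) - 2 * arctan c) / (4 * sqrt 5)"
    by (simp add: field_simps)
  have summand: "((A * x) ^ (4*n+3) / real (4*n+3) + (B * x) ^ (4*n+3) / real (4*n+3)) / sqrt 5
      = 1 / (4 * real n + 3) * real (fib (k * (4*n+3))) * x ^ (4*n+3)" for n
  proof -
    have "odd (k * (4*n+3))"
      using k by simp
    then have "sqrt 5 * real (fib (k * (4*n+3))) = A ^ (4*n+3) + B ^ (4*n+3)"
      unfolding A_def B_def power_mult[symmetric] by (rule sqrt5_fib_odd)
    then have "real (fib (k * (4*n+3))) = (A ^ (4*n+3) + B ^ (4*n+3)) / sqrt 5"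
      by (simp add: eq_divide_eq mult.commute)
    then show ?thesis
      by (simp add: power_mult_distrib add_divide_distrib algebra_simps)
  qed
  have "(\<lambda>n. ((A * x) ^ (4*n+3) / real (4*n+3) + (B * x) ^ (4*n+3) / real (4*n+3)) / sqrt 5) sums
      (((artanh (A * x) - arctan (A * x)) / 2 + (artanh (B * x) - arctan (B * x)) / 2) / sqrt 5)"
    by (intro sums_divide sums_add artanh_minus_arctan_sums small)
  then show ?thesis
    by (simp only: limit summand)
qed

text \<open>Doubling the angle gives 1 / sqrt 3 = tan (pi/6).\<close>

lemma arctan_2_minus_sqrt3: "arctan (2 - sqrt 3) = pi / 12"
proof -
  have "1 < sqrt (3::real)" "sqrt (3::real) < 2"
    by (simp_all add: real_less_lsqrt)
  then have "2 * arctan (2 - sqrt 3) = arctan (2 * (2 - sqrt 3) / (1 - (2 - sqrt 3)\<^sup>2))"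
    by (intro arctan_double) auto
  also have "1 - (2 - sqrt 3)\<^sup>2 = (2 * (2 - sqrt 3)) * sqrt 3"
    by (simp add: power2_eq_square algebra_simps)
  also have "2 * (2 - sqrt 3) / \<dots> = 1 / sqrt 3"
    using \<open>sqrt 3 < 2\<close> by simp
  also have "arctan (1 / sqrt 3) = pi / 6"
    by (rule arctan_unique) (auto simp: tan_30)
  finally show ?thesis by simp
qed

theorem theorem12:
  fixes m :: nat
  shows "summable (\<lambda>n::nat. 1 / (4 * real n + 3) * real (fib ((2*m+1) * (4*n+3))) *
            (2 * (2 - sqrt 3) /
              (sqrt 5 * real (fib (2*m+1)) +
               sqrt (5 * (real (fib (2*m+1)))^2 + 4 * (2 - sqrt 3)^2))) ^ (4*n+3))
       \<and> pi / 6 =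
          ln (((9 + 5 * sqrt 3) * sqrt 5 *
                 (sqrt 5 * (real (fib (2*m+1)))^2 +
                  real (fib (2*m+1)) * sqrt (5 * (real (fib (2*m+1)))^2 + 4 * (2 - sqrt 3)^2)) + 4) /
              ((5 + 3 * sqrt 3) * sqrt 5 *
                 (sqrt 5 * (real (fib (2*m+1)))^2 +
                  real (fib (2*m+1)) * sqrt (5 * (real (fib (2*m+1)))^2 + 4 * (2 - sqrt 3)^2)) + 4))
          - 4 * sqrt 5 *
            (\<Sum>n::nat. 1 / (4 * real n + 3) * real (fib ((2*m+1) * (4*n+3))) *
               (2 * (2 - sqrt 3) /
                 (sqrt 5 * real (fib (2*m+1)) +
                  sqrt (5 * (real (fib (2*m+1)))^2 + 4 * (2 - sqrt 3)^2))) ^ (4*n+3))"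
proof -
  define F where "F = real (fib (2*m+1))"
  define c :: real where "c = 2 - sqrt 3"
  define R where "R = sqrt (5 * F\<^sup>2 + 4 * c\<^sup>2)"
  \<comment> \<open>The positive root (R - sqrt 5 F) / (2 c) of c x^2 + sqrt 5 F x - c = 0, whose
    discriminant is R^2, with its numerator rationalised.\<close>
  define x where "x = 2 * c / (sqrt 5 * F + R)"
  define T where "T = sqrt 5 * (sqrt 5 * F\<^sup>2 + F * R)"
  have c: "0 < c" "c \<le> 1"
    by (simp_all add: c_def real_le_lsqrt real_le_rsqrt real_less_lsqrt)
  have F: "F > 0"
    unfolding F_def by (simp add: fib_neq_0_nat)
  have R: "R\<^sup>2 = 5 * F\<^sup>2 + 4 * c\<^sup>2" "R \<ge> 0"
    by (simp_all add: R_def)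
  have s: "sqrt 5 * F + R > 0"
    using F R(2) by (simp add: add_pos_nonneg)
  have x: "x > 0"
    using c s by (simp add: x_def)
  have xs: "x * (sqrt 5 * F + R) = 2 * c"
    using s by (simp add: x_def)
  have eq: "sqrt 5 * F * x = c * (1 - x\<^sup>2)"
  proof -
    \<comment> \<open>Multiplying by the squared denominator of \<open>x\<close> lets
      \<open>xs\<close> eliminate \<open>x\<close>, leaving an identity in F, R and c that follows
      from the value of R^2.\<close>
    have "(sqrt 5 * F * x) * (sqrt 5 * F + R)\<^sup>2 = c * ((sqrt 5 * F + R)\<^sup>2 - (x * (sqrt 5 * F + R))\<^sup>2)"
    proof -
      have "(sqrt 5 * F * x) * (sqrt 5 * F + R)\<^sup>2 = sqrt 5 * F * (sqrt 5 * F + R) * (2 * c)"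
        unfolding xs[symmetric] by (simp only: power2_eq_square ac_simps)
      also have "\<dots> = c * ((sqrt 5 * F + R)\<^sup>2 - 4 * c\<^sup>2)"
        using R(1) by (simp add: power2_sum power_mult_distrib) (simp add: algebra_simps power2_eq_square)
      also have "4 * c\<^sup>2 = (x * (sqrt 5 * F + R))\<^sup>2"
        unfolding xs by (simp add: power_mult_distrib)
      finally show ?thesis .
    qed
    also have "\<dots> = c * (1 - x\<^sup>2) * (sqrt 5 * F + R)\<^sup>2"
      by (simp only: power_mult_distrib[of x] left_diff_distrib right_diff_distrib
          mult.assoc mult_1 mult_1_right)
    finally show ?thesis
      using s by simp
  qed
  have T: "x\<^sup>2 * T = 2 * c\<^sup>2 * (1 - x\<^sup>2)"
  proof -
    \<comment> \<open>\<open>T\<close> factors as sqrt 5 F (sqrt 5 F + R); \<open>eq\<close> and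
      \<open>xs\<close> evaluate one factor each.\<close>
    have "x\<^sup>2 * T = (sqrt 5 * F * x) * (x * (sqrt 5 * F + R))"
      by (simp add: T_def power2_eq_square algebra_simps)
    then show ?thesis
      by (simp add: eq xs power2_eq_square)
  qed
  have c2: "c\<^sup>2 = 7 - 4 * sqrt 3"
    by (simp add: c_def power2_diff)
  have sqrt3: "sqrt 3 * (sqrt 3 * z) = 3 * z" for z
    by (simp flip: mult.assoc)
  \<comment> \<open>The factor x^2 removes \<open>T\<close>. The constants fit because (9 + 5 sqrt
    3) c^2 = 1 + c and, for the denominator, (5 + 3 sqrt 3) c^2 = 1 - c; moreover 2 (1 - x^2) + 4
    x^2 = 2 (1 + x^2).\<close>
  have "x\<^sup>2 * ((9 + 5 * sqrt 3) * T + 4) = (9 + 5 * sqrt 3) * (x\<^sup>2 * T) + 4 * x\<^sup>2"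
    by (simp add: algebra_simps)
  also have "\<dots> = 2 * (1 + x\<^sup>2 + c * (1 - x\<^sup>2))"
    unfolding T c2 by (simp add: c_def sqrt3 algebra_simps)
  finally have num: "x\<^sup>2 * ((9 + 5 * sqrt 3) * T + 4) = 2 * (1 + x\<^sup>2 + c * (1 - x\<^sup>2))" .
  have "x\<^sup>2 * ((5 + 3 * sqrt 3) * T + 4) = (5 + 3 * sqrt 3) * (x\<^sup>2 * T) + 4 * x\<^sup>2"
    by (simp add: algebra_simps)
  also have "\<dots> = 2 * (1 + x\<^sup>2 - c * (1 - x\<^sup>2))"
    unfolding T c2 by (simp add: c_def sqrt3 algebra_simps)
  finally have den: "x\<^sup>2 * ((5 + 3 * sqrt 3) * T + 4) = 2 * (1 + x\<^sup>2 - c * (1 - x\<^sup>2))" .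
  have ratio: "((9 + 5 * sqrt 3) * T + 4) / ((5 + 3 * sqrt 3) * T + 4)
      = (1 + x\<^sup>2 + c * (1 - x\<^sup>2)) / (1 + x\<^sup>2 - c * (1 - x\<^sup>2))"
  proof -
    have "((9 + 5 * sqrt 3) * T + 4) / ((5 + 3 * sqrt 3) * T + 4)
        = (x\<^sup>2 * ((9 + 5 * sqrt 3) * T + 4)) / (x\<^sup>2 * ((5 + 3 * sqrt 3) * T + 4))"
      using x by simp
    then show ?thesis
      unfolding num den mult_divide_mult_cancel_left_if by simp
  qed
  \<comment> \<open>With c = tan (pi/12), the term \<open>2 * arctan c\<close> of the limit is pi/6;
    solving for it gives the formula.\<close>
  have "odd (2*m+1)" by simp
  from fib_multiples_4n3_sums[OF this c x eq[unfolded F_def]]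
  have sums: "(\<lambda>n. 1 / (4 * real n + 3) * real (fib ((2*m+1) * (4*n+3))) * x ^ (4*n+3)) sums
     ((ln (((9 + 5 * sqrt 3) * T + 4) / ((5 + 3 * sqrt 3) * T + 4)) - pi / 6) / (4 * sqrt 5))"
    unfolding ratio by (simp add: c_def arctan_2_minus_sqrt3)
  have "pi / 6 = ln (((9 + 5 * sqrt 3) * T + 4) / ((5 + 3 * sqrt 3) * T + 4))
      - 4 * sqrt 5 * (\<Sum>n. 1 / (4 * real n + 3) * real (fib ((2*m+1) * (4*n+3))) * x ^ (4*n+3))"
    by (simp only: sums_unique[OF sums, symmetric]) simp
  with sums_summable[OF sums] show ?thesis
    unfolding T_def x_def R_def F_def c_def mult.assoc by (intro conjI)
qed

end
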